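(* There is a (lightface) $\Sigma^1_1$ equivalence relation on $2^{\mathbb{N}}$ which is Borel graphable but not $\Delta^1_1$-graphable.
   Context: An equivalence relation $E$ on $2^{\mathbb{N}}$ is Borel graphable (resp. $\Delta^1_1$-graphable) if there is a Borel (resp. lightface $\Delta^1_1$) graph on $2^{\mathbb{N}}$ whose connectedness relation ($x,y$ related iff joined by a finite path) equals $E$. *)

theory Defs
  imports "HOL-Analysis.Analysis" "HOL-Library.Nat_Bijection"
begin

text \<open>
  Partial recursive functions, in the one-argument presentation: tuples of arguments are
  passed through the Cantor pairing \<^const>\<open>prod_encode\<close>, so the two projections and
  pairing take the place of the usual projection functions and multi-argument composition.
\<close>

definition is_mu :: "(nat \<Rightarrow> nat option) \<Rightarrow> nat \<Rightarrow> nat \<Rightarrow> bool" where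
  "is_mu f a n \<longleftrightarrow> f (prod_encode (a, n)) = Some 0 \<and>
     (\<forall>m<n. \<exists>v. f (prod_encode (a, m)) = Some (Suc v))"

inductive partial_recursive :: "(nat \<Rightarrow> nat option) \<Rightarrow> bool" where
  zero: "partial_recursive (\<lambda>n. Some 0)"
| succ: "partial_recursive (\<lambda>n. Some (Suc n))"
| proj1: "partial_recursive (\<lambda>n. Some (fst (prod_decode n)))"
| proj2: "partial_recursive (\<lambda>n. Some (snd (prod_decode n)))"
| pair: "partial_recursive f \<Longrightarrow> partial_recursive g \<Longrightarrow>
    partial_recursive (\<lambda>n. Option.bind (f n) (\<lambda>a. Option.bind (g n) (\<lambda>b. Some (prod_encode (a, b)))))"
| comp: "partial_recursive f \<Longrightarrow> partial_recursive g \<Longrightarrow>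
    partial_recursive (\<lambda>n. Option.bind (g n) f)"
| prim_rec: "partial_recursive f \<Longrightarrow> partial_recursive g \<Longrightarrow>
    partial_recursive (\<lambda>n. case prod_decode n of (a, k) \<Rightarrow>
      rec_nat (f a) (\<lambda>j r. Option.bind r (\<lambda>v. g (prod_encode (a, prod_encode (j, v))))) k)"
| mu: "partial_recursive f \<Longrightarrow>
    partial_recursive (\<lambda>a. if \<exists>n. is_mu f a n then Some (THE n. is_mu f a n) else None)"

definition semirecursive :: "nat set \<Rightarrow> bool" where
  "semirecursive W \<longleftrightarrow> (\<exists>f. partial_recursive f \<and> W = dom f)"

type_synonym cantor = "nat \<Rightarrow> bool"
type_synonym baire = "nat \<Rightarrow> nat"

definition cyl :: "'a list \<Rightarrow> (nat \<Rightarrow> 'a) set" where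
  "cyl s = {x. \<forall>i<length s. x i = s ! i}"

definition box_code :: "bool list \<Rightarrow> bool list \<Rightarrow> nat list \<Rightarrow> nat" where
  "box_code s t u = prod_encode (list_encode (map of_bool s),
     prod_encode (list_encode (map of_bool t), list_encode u))"

text \<open>
  Lightface classes. A set is \<open>\<Sigma>\<^sup>0\<^sub>1\<close> if it is the union of a semirecursive family of
  basic open boxes, \<open>\<Pi>\<^sup>0\<^sub>1\<close> if its complement is \<open>\<Sigma>\<^sup>0\<^sub>1\<close>, and \<open>\<Sigma>\<^sup>1\<^sub>1\<close> if it is the projection
  along Baire space of a \<open>\<Pi>\<^sup>0\<^sub>1\<close> set.
\<close>

definition lightface_Sigma01 :: "(cantor \<times> cantor \<times> baire) set \<Rightarrow> bool" where
  "lightface_Sigma01 P \<longleftrightarrow> (\<exists>W. semirecursive W \<and>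
     P = {(x, y, z). \<exists>s t u. box_code s t u \<in> W \<and> x \<in> cyl s \<and> y \<in> cyl t \<and> z \<in> cyl u})"

definition lightface_Pi01 :: "(cantor \<times> cantor \<times> baire) set \<Rightarrow> bool" where
  "lightface_Pi01 P \<longleftrightarrow> lightface_Sigma01 (- P)"

definition lightface_Sigma11 :: "(cantor \<times> cantor) set \<Rightarrow> bool" where
  "lightface_Sigma11 A \<longleftrightarrow> (\<exists>P. lightface_Pi01 P \<and> A = {(x, y). \<exists>z. (x, y, z) \<in> P})"

definition lightface_Delta11 :: "(cantor \<times> cantor) set \<Rightarrow> bool" where
  "lightface_Delta11 A \<longleftrightarrow> lightface_Sigma11 A \<and> lightface_Sigma11 (- A)"

definition simple_graph :: "('a \<times> 'a) set \<Rightarrow> bool" where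
  "simple_graph G \<longleftrightarrow> irrefl G \<and> sym G"

definition Borel_graphable :: "(cantor \<times> cantor) set \<Rightarrow> bool" where
  "Borel_graphable E \<longleftrightarrow> (\<exists>G. simple_graph G \<and> G \<in> sets borel \<and> G\<^sup>* = E)"

definition Delta11_graphable :: "(cantor \<times> cantor) set \<Rightarrow> bool" where
  "Delta11_graphable E \<longleftrightarrow> (\<exists>G. simple_graph G \<and> lightface_Delta11 G \<and> G\<^sup>* = E)"

end

theory Submission
  imports Defs
begin

text \<open>
  Let \<open>U\<^sub>n\<close> enumerate the \<open>\<Sigma>\<^sup>1\<^sub>1\<close> relations, and let \<open>a\<^sub>n\<close> be the characteristic function of
  \<open>{n}\<close> and \<open>b\<^sub>n\<close> that of its complement. The relation \<open>E\<close> identifies \<open>a\<^sub>n\<close> with \<open>b\<^sub>n\<close> exactly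
  when \<open>(a\<^sub>n, b\<^sub>n) \<in> U\<^sub>n\<close>, and nothing else. It differs from equality by a countable set,
  so it is Borel graphable. Since its classes have at most two elements, a graph \<open>G\<close> generating \<open>E\<close>
  contains \<open>(a\<^sub>n, b\<^sub>n)\<close> iff \<open>E\<close> does; if the complement of \<open>G\<close> were \<open>U\<^sub>n\<close>, this would fail at \<open>n\<close>.
  That \<open>E\<close> is \<open>\<Sigma>\<^sup>1\<^sub>1\<close> rests on a universal semirecursive set, obtained by searching for
  finite derivations in a calculus of evaluation statements.
\<close>

section \<open>Recursive functions and decidable predicates\<close>

notation (input) prod_encode ("\<langle>_\<rangle>")

abbreviation p1 :: "nat \<Rightarrow> nat" where "p1 x \<equiv> fst (prod_decode x)"
abbreviation p2 :: "nat \<Rightarrow> nat" where "p2 x \<equiv> snd (prod_decode x)"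

definition recursive :: "(nat \<Rightarrow> nat) \<Rightarrow> bool" where
  "recursive f \<longleftrightarrow> partial_recursive (\<lambda>n. Some (f n))"

definition decidable :: "(nat \<Rightarrow> bool) \<Rightarrow> bool" where
  "decidable P \<longleftrightarrow> recursive (\<lambda>n. of_bool (P n))"

named_theorems rec_intros

lemma recursive_comp: "recursive f \<Longrightarrow> recursive g \<Longrightarrow> recursive (\<lambda>x. f (g x))"
  unfolding recursive_def by (drule (1) partial_recursive.comp) simp

lemma recursive_pair [rec_intros]:
  "recursive f \<Longrightarrow> recursive g \<Longrightarrow> recursive (\<lambda>x. \<langle>(f x, g x)\<rangle>)"
  unfolding recursive_def by (drule (1) partial_recursive.pair) simp

lemma recursive_Suc [rec_intros]: "recursive f \<Longrightarrow> recursive (\<lambda>x. Suc (f x))"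
  by (rule recursive_comp[of Suc]) (simp_all add: recursive_def partial_recursive.succ)

lemma recursive_p1 [rec_intros]: "recursive f \<Longrightarrow> recursive (\<lambda>x. p1 (f x))"
  by (rule recursive_comp[of p1]) (simp_all add: recursive_def partial_recursive.proj1)

lemma recursive_p2 [rec_intros]: "recursive f \<Longrightarrow> recursive (\<lambda>x. p2 (f x))"
  by (rule recursive_comp[of p2]) (simp_all add: recursive_def partial_recursive.proj2)

lemma recursive_id [rec_intros]: "recursive (\<lambda>x. x)"
proof -
  have "recursive p1" "recursive p2"
    by (simp_all add: recursive_def partial_recursive.proj1 partial_recursive.proj2)
  from recursive_pair[OF this] show ?thesis by simp
qed

lemma recursive_const [rec_intros]: "recursive (\<lambda>x. c)"
proof (induction c)
  case 0
  show ?case by (simp add: recursive_def partial_recursive.zero)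
qed (rule recursive_Suc)

text \<open>The step function reads parameter, stage and previous value off one coded triple, which
  is the format of the clause \<open>prim_rec\<close>. Totality makes every
  \<open>Option.bind\<close> succeed.\<close>

lemma recursive_rec_nat:
  assumes f: "recursive f" and k: "recursive k"
    and g: "recursive (\<lambda>e. g (p1 e) (p1 (p2 e)) (p2 (p2 e)))"
  shows "recursive (\<lambda>x. rec_nat (f x) (g x) (k x))"
proof -
  have "rec_nat (Some (f a))
      (\<lambda>j r. Option.bind r (\<lambda>v. Some (g (p1 \<langle>(a, \<langle>(j, v)\<rangle>)\<rangle>) (p1 (p2 \<langle>(a, \<langle>(j, v)\<rangle>)\<rangle>)) (p2 (p2 \<langle>(a, \<langle>(j, v)\<rangle>)\<rangle>))))) m
    = Some (rec_nat (f a) (g a) m)" for a m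
    by (induction m) simp_all
  with partial_recursive.prim_rec[OF f[unfolded recursive_def] g[unfolded recursive_def]]
  have "recursive (\<lambda>n. rec_nat (f (p1 n)) (g (p1 n)) (p2 n))"
    by (simp add: recursive_def case_prod_beta)
  from recursive_comp[OF this recursive_pair[OF recursive_id k]] show ?thesis
    by simp
qed

lemma decidable_comp: "decidable P \<Longrightarrow> recursive f \<Longrightarrow> decidable (\<lambda>x. P (f x))"
  unfolding decidable_def by (rule recursive_comp)

text \<open>A case distinction is a primitive recursion of length 0 or 1: \<open>g x\<close> is the
  starting value, and one step replaces it by \<open>f x\<close>.\<close>

lemma recursive_If:
  assumes "decidable P" "recursive f" "recursive g"
  shows "recursive (\<lambda>x. if P x then f x else g x)"
proof -
  have "recursive (\<lambda>x. rec_nat (g x) (\<lambda>_ _. f x) (of_bool (P x)))"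
    using assms by (intro recursive_rec_nat recursive_comp[OF assms(2)] rec_intros) (simp_all add: decidable_def)
  moreover have "rec_nat (g x) (\<lambda>_ _. f x) (of_bool (P x)) = (if P x then f x else g x)" for x
    by simp
  ultimately show ?thesis by simp
qed

text \<open>Truncated subtraction iterates the predecessor, and the predecessor is the recursion
  that returns its last stage index.\<close>

lemma recursive_diff [rec_intros]:
  assumes "recursive f" "recursive g"
  shows "recursive (\<lambda>x. f x - g x)"
proof -
  have pred: "recursive (\<lambda>x. h x - 1)" if "recursive h" for h
  proof -
    have "recursive (\<lambda>x. rec_nat 0 (\<lambda>j _. j) (h x))"
      using that by (intro recursive_rec_nat rec_intros)
    moreover have "rec_nat 0 (\<lambda>j _. j) m = m - 1" for m :: nat
      by (cases m) simp_all
    ultimately show ?thesis by simp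
  qed
  have "recursive (\<lambda>x. rec_nat (f x) (\<lambda>_ r. r - 1) (g x))"
    using assms by (intro recursive_rec_nat pred rec_intros)
  moreover have "rec_nat a (\<lambda>_ r. r - 1) m = a - m" for a m :: nat
    by (induction m) simp_all
  ultimately show ?thesis by simp
qed

lemma decidable_eq_0:
  assumes "recursive f"
  shows "decidable (\<lambda>x. f x = 0)"
proof -
  have "recursive (\<lambda>x. 1 - f x)"
    using assms by (intro rec_intros)
  moreover have "1 - f x = of_bool (f x = 0)" for x
    by simp
  ultimately show ?thesis by (simp add: decidable_def)
qed

lemma decidable_not [rec_intros]:
  assumes "decidable P"
  shows "decidable (\<lambda>x. \<not> P x)"
  using decidable_eq_0[OF assms[unfolded decidable_def]] by simp

lemma decidable_conj [rec_intros]: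
  assumes "decidable P" "decidable Q"
  shows "decidable (\<lambda>x. P x \<and> Q x)"
proof -
  have "recursive (\<lambda>x. if P x then of_bool (Q x) else 0)"
    using assms by (intro recursive_If rec_intros) (simp_all add: decidable_def)
  moreover have "(if P x then of_bool (Q x) else 0) = (of_bool (P x \<and> Q x) :: nat)" for x
    by simp
  ultimately show ?thesis by (simp only: decidable_def)
qed

lemma decidable_disj [rec_intros]:
  assumes "decidable P" "decidable Q"
  shows "decidable (\<lambda>x. P x \<or> Q x)"
proof -
  have "decidable (\<lambda>x. \<not> (\<not> P x \<and> \<not> Q x))"
    using assms by (intro rec_intros)
  then show ?thesis by simp
qed

lemma decidable_eq [rec_intros]:
  assumes "recursive f" "recursive g"
  shows "decidable (\<lambda>x. f x = g x)"
proof -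
  have "decidable (\<lambda>x. f x - g x = 0 \<and> g x - f x = 0)"
    using assms by (intro rec_intros decidable_eq_0)
  moreover have "f x - g x = 0 \<and> g x - f x = 0 \<longleftrightarrow> f x = g x" for x
    by auto
  ultimately show ?thesis by simp
qed

lemma recursive_of_bool [rec_intros]: "decidable P \<Longrightarrow> recursive (\<lambda>x. of_bool (P x))"
  by (simp add: decidable_def)

text \<open>A recursion of length \<open>b x\<close> accumulates the disjunction of the instances of
  \<open>P x\<close>.\<close>

lemma decidable_ex_less [rec_intros]:
  assumes b: "recursive b" and P: "decidable (\<lambda>e. P (p1 e) (p2 e))"
  shows "decidable (\<lambda>x. \<exists>i<b x. P x i)"
proof -
  \<comment> \<open>The recursion step sees a triple of parameter, stage and previous value, so
    \<open>P\<close> has to be read off its first two entries.\<close>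
  have P': "decidable (\<lambda>e. P (p1 e) (p1 (p2 e)))"
    using decidable_comp[OF P, of "\<lambda>e. \<langle>(p1 e, p1 (p2 e))\<rangle>"]
      recursive_pair[OF recursive_p1 recursive_p1[OF recursive_p2], OF recursive_id recursive_id]
    by simp
  have "recursive (\<lambda>x. rec_nat 0 (\<lambda>j r. if P x j then 1 else r) (b x))"
    by (intro recursive_rec_nat recursive_If rec_intros b P')
  moreover have "rec_nat 0 (\<lambda>j r. if P x j then 1 else r) m = (of_bool (\<exists>i<m. P x i) :: nat)" for x m
    by (induction m) (auto simp: less_Suc_eq)
  ultimately show ?thesis by (simp add: decidable_def)
qed

section \<open>Coded lists\<close>

text \<open>This makes quantification over the positions of a coded list a bounded search. A code
  \<open>Suc k\<close> has its tail coded by \<open>p2 k\<close>, which is at most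
  \<open>k\<close>.\<close>

lemma length_list_decode_le: "length (list_decode m) \<le> m"
proof (induction m rule: less_induct)
  case (less m)
  show ?case
  proof (cases m)
    case (Suc k)
    have "p2 k \<le> k"
      by (metis le_prod_encode_2 prod.collapse prod_decode_inverse)
    with less[of "p2 k"] Suc show ?thesis
      by (simp add: case_prod_beta)
  qed simp
qed

lemma list_encode_eq_0: "list_encode xs = 0 \<longleftrightarrow> xs = []"
  by (cases xs) simp_all

text \<open>The formula survives at code 0: the predecessor is again 0, and \<open>p2 0 = 0\<close>
  codes the empty list.\<close>

lemma tl_list_decode: "list_encode (tl (list_decode m)) = p2 (m - 1)"
proof (cases m)
  case 0
  have "prod_decode 0 = (0, 0)"
    using prod_encode_inverse[of "(0, 0)"] by (simp add: prod_encode_def)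
  with 0 show ?thesis by simp
qed (simp add: case_prod_beta)

lemma recursive_drop [rec_intros]:
  assumes "recursive k" "recursive l"
  shows "recursive (\<lambda>x. list_encode (drop (k x) (list_decode (l x))))"
proof -
  have "rec_nat m (\<lambda>_ r. p2 (r - 1)) j = list_encode (drop j (list_decode m))" for m j
    using tl_list_decode[of "list_encode (drop _ (list_decode m))"]
    by (induction j) (simp_all add: drop_Suc drop_tl)
  moreover have "recursive (\<lambda>x. rec_nat (l x) (\<lambda>_ r. p2 (r - 1)) (k x))"
    using assms by (intro recursive_rec_nat rec_intros)
  ultimately show ?thesis by simp
qed

lemma recursive_tl [rec_intros]:
  "recursive l \<Longrightarrow> recursive (\<lambda>x. list_encode (tl (list_decode (l x))))"
  unfolding tl_list_decode by (intro rec_intros)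

lemma recursive_hd [rec_intros]:
  assumes "recursive l"
  shows "recursive (\<lambda>x. hd (list_decode (l x)))"
proof -
  \<comment> \<open>The head of the empty list is unspecified but is one fixed number, so a constant
    function covers this case.\<close>
  have "hd (list_decode m) = (if m = 0 then hd [] else p1 (m - 1))" for m
    by (cases m) (simp_all add: case_prod_beta)
  then show ?thesis
    using assms by (simp only:) (intro recursive_If rec_intros)
qed

lemma recursive_hd_drop [rec_intros]:
  assumes "recursive k" "recursive l"
  shows "recursive (\<lambda>x. hd (drop (k x) (list_decode (l x))))"
  using recursive_hd[OF recursive_drop[OF assms]] by simp

text \<open>Position \<open>k x\<close> exists iff dropping \<open>k x\<close> entries leaves a
  nonempty list, and 0 codes the empty list alone.\<close>

lemma decidable_less_length [rec_intros]:
  assumes "recursive k" "recursive l"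
  shows "decidable (\<lambda>x. k x < length (list_decode (l x)))"
proof -
  have "decidable (\<lambda>x. list_encode (drop (k x) (list_decode (l x))) \<noteq> 0)"
    using assms by (intro rec_intros)
  then show ?thesis by (simp add: list_encode_eq_0 not_le)
qed

lemma decidable_ex_length [rec_intros]:
  assumes "recursive l" "decidable (\<lambda>e. P (p1 e) (p2 e))"
  shows "decidable (\<lambda>x. \<exists>i<length (list_decode (l x)). P x i)"
proof -
  have "decidable (\<lambda>x. \<exists>i<l x. i < length (list_decode (l x)) \<and> P x i)"
    using assms by (intro rec_intros recursive_comp[OF assms(1)])
  moreover have "(\<exists>i<l x. i < length (list_decode (l x)) \<and> P x i) \<longleftrightarrow>
      (\<exists>i<length (list_decode (l x)). P x i)" for x
    using length_list_decode_le less_le_trans by blast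
  ultimately show ?thesis by simp
qed

lemma decidable_all_length [rec_intros]:
  assumes "recursive l" "decidable (\<lambda>e. P (p1 e) (p2 e))"
  shows "decidable (\<lambda>x. \<forall>i<length (list_decode (l x)). P x i)"
proof -
  have "decidable (\<lambda>x. \<not> (\<exists>i<length (list_decode (l x)). \<not> P x i))"
    using assms by (intro rec_intros)
  then show ?thesis by simp
qed

lemma bex_set_iff_hd_drop: "(\<exists>q\<in>set xs. P q) \<longleftrightarrow> (\<exists>i<length xs. P (hd (drop i xs)))"
  by (metis hd_drop_conv_nth in_set_conv_nth)

lemma decidable_bex_list [rec_intros]:
  assumes "recursive l" "decidable (\<lambda>e. P (p1 e) (p2 e))"
  shows "decidable (\<lambda>x. \<exists>q\<in>set (list_decode (l x)). P x q)"
  unfolding bex_set_iff_hd_drop using assms(1)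
proof (rule decidable_ex_length)
  have "recursive (\<lambda>e. \<langle>(p1 e, hd (drop (p2 e) (list_decode (l (p1 e)))))\<rangle>)"
    by (intro rec_intros recursive_comp[OF assms(1)])
  from recursive_comp[OF assms(2)[unfolded decidable_def] this]
  show "decidable (\<lambda>e. P (p1 e) (hd (drop (p2 e) (list_decode (l (p1 e))))))"
    by (simp add: decidable_def)
qed

section \<open>Semidecidable predicates\<close>

text \<open>Semidecidability as projection of a decidable relation, a form convenient for closure
  under quantifiers and connectives; \<open>semirecursive_sigma1\<close> passes from it to domains
  of partial recursive functions.\<close>

definition sigma1 :: "(nat \<Rightarrow> bool) \<Rightarrow> bool" where
  "sigma1 P \<longleftrightarrow> (\<exists>D. decidable D \<and> (\<forall>x. P x \<longleftrightarrow> (\<exists>m. D \<langle>(x, m)\<rangle>)))"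

lemma sigma1_decidable: "decidable P \<Longrightarrow> sigma1 P"
  unfolding sigma1_def
  by (rule exI[of _ "\<lambda>e. P (p1 e)"]) (simp add: decidable_comp[of P] rec_intros)

lemma sigma1_comp:
  assumes "sigma1 P" "recursive f"
  shows "sigma1 (\<lambda>x. P (f x))"
proof -
  obtain D where D: "decidable D" "\<And>x. P x \<longleftrightarrow> (\<exists>m. D \<langle>(x, m)\<rangle>)"
    using assms(1) by (auto simp: sigma1_def)
  have "decidable (\<lambda>e. D \<langle>(f (p1 e), p2 e)\<rangle>)"
    by (intro decidable_comp[OF D(1)] rec_intros recursive_comp[OF assms(2)])
  with D(2) show ?thesis unfolding sigma1_def by fastforce
qed

text \<open>Two nested unbounded searches merge into one search over coded pairs.\<close>

lemma sigma1_ex: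
  assumes "sigma1 (\<lambda>e. P (p1 e) (p2 e))"
  shows "sigma1 (\<lambda>x. \<exists>m. P x m)"
proof -
  obtain D where D: "decidable D" "\<And>e. P (p1 e) (p2 e) \<longleftrightarrow> (\<exists>m. D \<langle>(e, m)\<rangle>)"
    using assms by (auto simp: sigma1_def)
  have "decidable (\<lambda>e. D \<langle>(\<langle>(p1 e, p1 (p2 e))\<rangle>, p2 (p2 e))\<rangle>)"
    by (intro decidable_comp[OF D(1)] rec_intros)
  moreover have "(\<exists>m. P x m) \<longleftrightarrow> (\<exists>m. D \<langle>(\<langle>(x, p1 m)\<rangle>, p2 m)\<rangle>)" for x
    using D(2)[of "\<langle>(x, _)\<rangle>"] by (metis fst_conv prod_encode_inverse snd_conv)
  ultimately show ?thesis unfolding sigma1_def by fastforce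
qed

lemma sigma1_conj:
  assumes "sigma1 P" "sigma1 Q"
  shows "sigma1 (\<lambda>x. P x \<and> Q x)"
proof -
  obtain D where D: "decidable D" "\<And>x. P x \<longleftrightarrow> (\<exists>m. D \<langle>(x, m)\<rangle>)"
    using assms(1) by (auto simp: sigma1_def)
  obtain D' where D': "decidable D'" "\<And>x. Q x \<longleftrightarrow> (\<exists>m. D' \<langle>(x, m)\<rangle>)"
    using assms(2) by (auto simp: sigma1_def)
  have "sigma1 (\<lambda>x. \<exists>m m'. D \<langle>(x, m)\<rangle> \<and> D' \<langle>(x, m')\<rangle>)"
    by (intro sigma1_ex sigma1_decidable decidable_comp[OF D(1)] decidable_comp[OF D'(1)] rec_intros)
  with D(2) D'(2) show ?thesis by simp
qed

lemma sigma1_disj: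
  assumes "sigma1 P" "sigma1 Q"
  shows "sigma1 (\<lambda>x. P x \<or> Q x)"
proof -
  obtain D where D: "decidable D" "\<And>x. P x \<longleftrightarrow> (\<exists>m. D \<langle>(x, m)\<rangle>)"
    using assms(1) by (auto simp: sigma1_def)
  obtain D' where D': "decidable D'" "\<And>x. Q x \<longleftrightarrow> (\<exists>m. D' \<langle>(x, m)\<rangle>)"
    using assms(2) by (auto simp: sigma1_def)
  have "decidable (\<lambda>x. D x \<or> D' x)"
    using D(1) D'(1) by (rule decidable_disj)
  with D(2) D'(2) show ?thesis unfolding sigma1_def by blast
qed

lemma semirecursive_sigma1:
  assumes "sigma1 P"
  shows "semirecursive {x. P x}"
proof -
  obtain D where D: "decidable D" "\<And>x. P x \<longleftrightarrow> (\<exists>m. D \<langle>(x, m)\<rangle>)"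
    using assms by (auto simp: sigma1_def)
  \<comment> \<open>Minimization looks for the value 0, so success is coded by 0 and failure by
    1.\<close>
  define f where "f = (\<lambda>e. Some (of_bool (\<not> D e)) :: nat option)"
  have "(\<exists>n. is_mu f a n) \<longleftrightarrow> P a" for a
  proof
    assume "P a"
    then obtain m where m: "D \<langle>(a, m)\<rangle>" using D(2) by blast
    \<comment> \<open>\<open>is_mu\<close> demands positive values below its result, hence the least
      witness.\<close>
    define k where "k = (LEAST m. D \<langle>(a, m)\<rangle>)"
    have "D \<langle>(a, k)\<rangle>"
      unfolding k_def using m by (rule LeastI)
    moreover have "\<not> D \<langle>(a, j)\<rangle>" if "j < k" for j
      using that unfolding k_def by (rule not_less_Least)
    ultimately have "is_mu f a k"
      by (simp add: is_mu_def f_def)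
    then show "\<exists>n. is_mu f a n" ..
  next
    assume "\<exists>n. is_mu f a n"
    then obtain n where "f \<langle>(a, n)\<rangle> = Some 0" by (auto simp: is_mu_def)
    then show "P a" by (auto simp: f_def D(2))
  qed
  then have "dom (\<lambda>a. if \<exists>n. is_mu f a n then Some (THE n. is_mu f a n) else None) = {x. P x}"
    by (auto simp: dom_def)
  moreover have "partial_recursive f"
    using decidable_not[OF D(1)] by (simp add: f_def decidable_def recursive_def)
  ultimately show ?thesis
    unfolding semirecursive_def using partial_recursive.mu by blast
qed

section \<open>Sets generated by decidable axioms and rules\<close>

text \<open>A rule with a single premise is modelled by a \<open>J\<close> that ignores its other
  argument; the premise can then be supplied twice.\<close>

inductive rule_closure :: "(nat \<Rightarrow> bool) \<Rightarrow> (nat \<Rightarrow> nat \<Rightarrow> nat \<Rightarrow> bool) \<Rightarrow> nat \<Rightarrow> bool"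
  for Ax J where
  ax: "Ax c \<Longrightarrow> rule_closure Ax J c"
| step: "rule_closure Ax J q \<Longrightarrow> rule_closure Ax J r \<Longrightarrow> J q r c \<Longrightarrow> rule_closure Ax J c"

text \<open>Derivations are listed backwards, the latest conclusion first, so that premises are
  sought further down the list and derivations grow by \<open>Cons\<close>.\<close>

definition derivation :: "(nat \<Rightarrow> bool) \<Rightarrow> (nat \<Rightarrow> nat \<Rightarrow> nat \<Rightarrow> bool) \<Rightarrow> nat list \<Rightarrow> bool" where
  "derivation Ax J cs \<longleftrightarrow> (\<forall>i<length cs. Ax (hd (drop i cs)) \<or>
     (\<exists>q\<in>set (drop (Suc i) cs). \<exists>r\<in>set (drop (Suc i) cs). J q r (hd (drop i cs))))"

lemma derivation_Cons:
  "derivation Ax J (c # cs) \<longleftrightarrow>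
     (Ax c \<or> (\<exists>q\<in>set cs. \<exists>r\<in>set cs. J q r c)) \<and> derivation Ax J cs"
  unfolding derivation_def length_Cons All_less_Suc2 by simp

lemma derivation_sound: "derivation Ax J cs \<Longrightarrow> c \<in> set cs \<Longrightarrow> rule_closure Ax J c"
  by (induction cs arbitrary: c) (auto simp: derivation_Cons intro: rule_closure.intros)

lemma derivation_append:
  "derivation Ax J cs \<Longrightarrow> derivation Ax J ds \<Longrightarrow> derivation Ax J (cs @ ds)"
  by (induction cs) (auto simp: derivation_Cons)

text \<open>The conclusion of a rule goes in front of the concatenated derivations of its two
  premises.\<close>

lemma derivation_complete: "rule_closure Ax J c \<Longrightarrow> \<exists>cs. derivation Ax J cs \<and> c \<in> set cs"
proof (induction rule: rule_closure.induct)
  case (ax c)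
  then have "derivation Ax J [c]"
    by (simp add: derivation_def)
  then show ?case by (meson list.set_intros(1))
next
  case (step q r c)
  then obtain cs ds where "derivation Ax J cs" "q \<in> set cs" "derivation Ax J ds" "r \<in> set ds"
    by blast
  with step.hyps have "derivation Ax J (c # cs @ ds)"
    by (auto simp: derivation_Cons intro: derivation_append)
  then show ?case by (meson list.set_intros(1))
qed

text \<open>A coded derivation that contains \<open>c\<close> is the witness, and checking it takes
  bounded searches only.\<close>

lemma sigma1_rule_closure:
  assumes Ax: "decidable Ax" and J: "decidable (\<lambda>e. J (p1 e) (p1 (p2 e)) (p2 (p2 e)))"
  shows "sigma1 (rule_closure Ax J)"
proof -
  have J': "decidable (\<lambda>x. J (f x) (g x) (h x))" if "recursive f" "recursive g" "recursive h" for f g h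
    using decidable_comp[OF J recursive_pair[OF that(1) recursive_pair[OF that(2,3)]]] by simp
  \<comment> \<open>The remaining list is encoded and decoded again so that
    \<open>decidable_bex_list\<close>, which speaks of coded lists, applies to it.\<close>
  have "decidable (\<lambda>d. \<forall>i<length (list_decode d). Ax (hd (drop i (list_decode d))) \<or>
     (\<exists>q\<in>set (list_decode (list_encode (drop (Suc i) (list_decode d)))).
      \<exists>r\<in>set (list_decode (list_encode (drop (Suc i) (list_decode d)))). J q r (hd (drop i (list_decode d)))))"
    by (intro decidable_comp[OF Ax] J' rec_intros)
  then have deriv: "decidable (\<lambda>d. derivation Ax J (list_decode d))"
    by (simp add: derivation_def)
  have "sigma1 (\<lambda>c. \<exists>d. derivation Ax J (list_decode d) \<and> (\<exists>q\<in>set (list_decode d). q = c))"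
    by (intro sigma1_ex sigma1_decidable decidable_comp[OF deriv] rec_intros)
  moreover have "rule_closure Ax J c \<longleftrightarrow>
      (\<exists>d. derivation Ax J (list_decode d) \<and> (\<exists>q\<in>set (list_decode d). q = c))" for c
    by (metis derivation_sound derivation_complete list_encode_inverse)
  ultimately show ?thesis by presburger
qed

section \<open>A universal evaluation relation\<close>

text \<open>
  The code \<open>(8, e)\<close> evaluates to 0 at \<open>(a, n)\<close> if \<open>e\<close> takes nonzero values at all \<open>(a, m)\<close> with
  \<open>m < n\<close>; it splits the minimization rule into rules with at most two premises.
\<close>

inductive ev :: "nat \<Rightarrow> nat \<Rightarrow> nat \<Rightarrow> bool" where
  "ev \<langle>(0, c)\<rangle> n 0"
| "ev \<langle>(1, c)\<rangle> n (Suc n)"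
| "ev \<langle>(2, c)\<rangle> n (p1 n)"
| "ev \<langle>(3, c)\<rangle> n (p2 n)"
| "ev e n a \<Longrightarrow> ev e' n b \<Longrightarrow> ev \<langle>(4, \<langle>(e, e')\<rangle>)\<rangle> n \<langle>(a, b)\<rangle>"
| "ev e' n a \<Longrightarrow> ev e a v \<Longrightarrow> ev \<langle>(5, \<langle>(e, e')\<rangle>)\<rangle> n v"
| "ev e a v \<Longrightarrow> ev \<langle>(6, \<langle>(e, e')\<rangle>)\<rangle> \<langle>(a, 0)\<rangle> v"
| "ev \<langle>(6, \<langle>(e, e')\<rangle>)\<rangle> \<langle>(a, j)\<rangle> r \<Longrightarrow> ev e' \<langle>(a, \<langle>(j, r)\<rangle>)\<rangle> v \<Longrightarrow>
     ev \<langle>(6, \<langle>(e, e')\<rangle>)\<rangle> \<langle>(a, Suc j)\<rangle> v"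
| "ev e \<langle>(a, n)\<rangle> 0 \<Longrightarrow> ev \<langle>(8, e)\<rangle> \<langle>(a, n)\<rangle> 0 \<Longrightarrow> ev \<langle>(7, e)\<rangle> a n"
| "ev \<langle>(8, e)\<rangle> \<langle>(a, 0)\<rangle> 0"
| "ev \<langle>(8, e)\<rangle> \<langle>(a, n)\<rangle> 0 \<Longrightarrow> ev e \<langle>(a, n)\<rangle> (Suc v) \<Longrightarrow> ev \<langle>(8, e)\<rangle> \<langle>(a, Suc n)\<rangle> 0"

definition ev_ax :: "nat \<Rightarrow> nat \<Rightarrow> nat \<Rightarrow> bool" where
  "ev_ax e n v \<longleftrightarrow> p1 e = 0 \<and> v = 0 \<or> p1 e = 1 \<and> v = Suc n \<or> p1 e = 2 \<and> v = p1 n \<or>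
     p1 e = 3 \<and> v = p2 n \<or> p1 e = 8 \<and> p2 n = 0 \<and> v = 0"

text \<open>
  A decidable form of the rules with premises: the intermediate values, which \<open>ev.intros\<close> quantifies,
  are read off the coded premises \<open>q\<close> and \<open>r\<close>.
\<close>

definition ev_step :: "nat \<Rightarrow> nat \<Rightarrow> nat \<Rightarrow> nat \<Rightarrow> nat \<Rightarrow> bool" where
  "ev_step q r e n v \<longleftrightarrow>
     p1 e = 4 \<and> q = \<langle>(p1 (p2 e), \<langle>(n, p1 v)\<rangle>)\<rangle> \<and> r = \<langle>(p2 (p2 e), \<langle>(n, p2 v)\<rangle>)\<rangle> \<or>
     p1 e = 5 \<and> q = \<langle>(p2 (p2 e), \<langle>(n, p2 (p2 q))\<rangle>)\<rangle> \<and> r = \<langle>(p1 (p2 e), \<langle>(p2 (p2 q), v)\<rangle>)\<rangle> \<or>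
     p1 e = 6 \<and> p2 n = 0 \<and> q = \<langle>(p1 (p2 e), \<langle>(p1 n, v)\<rangle>)\<rangle> \<or>
     p1 e = 6 \<and> p2 n \<noteq> 0 \<and> q = \<langle>(e, \<langle>(\<langle>(p1 n, p2 n - 1)\<rangle>, p2 (p2 q))\<rangle>)\<rangle> \<and>
       r = \<langle>(p2 (p2 e), \<langle>(\<langle>(p1 n, \<langle>(p2 n - 1, p2 (p2 q))\<rangle>)\<rangle>, v)\<rangle>)\<rangle> \<or>
     p1 e = 7 \<and> q = \<langle>(p2 e, \<langle>(\<langle>(n, v)\<rangle>, 0)\<rangle>)\<rangle> \<and> r = \<langle>(\<langle>(8, p2 e)\<rangle>, \<langle>(\<langle>(n, v)\<rangle>, 0)\<rangle>)\<rangle> \<or>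
     p1 e = 8 \<and> p2 n \<noteq> 0 \<and> v = 0 \<and> q = \<langle>(e, \<langle>(\<langle>(p1 n, p2 n - 1)\<rangle>, 0)\<rangle>)\<rangle> \<and>
       r = \<langle>(p2 e, \<langle>(\<langle>(p1 n, p2 n - 1)\<rangle>, Suc (p2 (p2 r) - 1))\<rangle>)\<rangle>"

abbreviation ev_closure :: "nat \<Rightarrow> bool" where
  "ev_closure \<equiv> rule_closure (\<lambda>c. ev_ax (p1 c) (p1 (p2 c)) (p2 (p2 c)))
     (\<lambda>q r c. ev_step q r (p1 c) (p1 (p2 c)) (p2 (p2 c)))"

lemma ev_imp_closure: "ev e n v \<Longrightarrow> ev_closure \<langle>(e, \<langle>(n, v)\<rangle>)\<rangle>"
proof (induction rule: ev.induct)
  case (7 e a v e')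
  \<comment> \<open>The base rule of primitive recursion has one premise, used here in both
    places.\<close>
  show ?case by (rule rule_closure.step[OF 7(2) 7(2)]) (simp add: ev_step_def)
qed ((rule rule_closure.ax; simp add: ev_ax_def; fail) |
     (rule rule_closure.step, assumption, assumption, simp add: ev_step_def; fail))+

lemma prod_decode_eq_iff: "prod_decode x = (a, b) \<longleftrightarrow> x = \<langle>(a, b)\<rangle>"
  by (metis prod_decode_inverse prod_encode_inverse)

lemma prod_encode_cases: obtains a b where "x = \<langle>(a, b)\<rangle>"
  by (metis prod_decode_eq_iff surj_pair)

text \<open>Once premises and conclusion are decoded, each disjunct of \<open>ev_step\<close>
  becomes an instance of a rule of \<open>ev\<close>.\<close>

lemma closure_imp_ev: "ev_closure c \<Longrightarrow> ev (p1 c) (p1 (p2 c)) (p2 (p2 c))"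
proof (induction rule: rule_closure.induct)
  case (ax c)
  obtain t d n v where c: "c = \<langle>(\<langle>(t, d)\<rangle>, \<langle>(n, v)\<rangle>)\<rangle>"
    by (metis prod_encode_cases)
  obtain a k where n: "n = \<langle>(a, k)\<rangle>"
    by (rule prod_encode_cases)
  from ax show ?case
    unfolding c by (auto simp: ev_ax_def n 
        intro: ev.intros ev.intros(2)[simplified]
          ev.intros(3,4)[of d "\<langle>(a, k)\<rangle>", simplified])
next
  case (step q r c)
  obtain t e e' n v where c: "c = \<langle>(\<langle>(t, \<langle>(e, e')\<rangle>)\<rangle>, \<langle>(n, v)\<rangle>)\<rangle>"
    by (metis prod_encode_cases)
  obtain a k where n: "n = \<langle>(a, k)\<rangle>"
    by (rule prod_encode_cases)
  obtain v1 v2 where v: "v = \<langle>(v1, v2)\<rangle>"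
    by (rule prod_encode_cases)
  obtain qe qn qv where q: "q = \<langle>(qe, \<langle>(qn, qv)\<rangle>)\<rangle>"
    by (metis prod_encode_cases)
  obtain re rn rv where r: "r = \<langle>(re, \<langle>(rn, rv)\<rangle>)\<rangle>"
    by (metis prod_encode_cases)
  have IH: "ev qe qn qv" "ev re rn rv"
    using step.IH by (simp_all add: q r)
  \<comment> \<open>In the last case \<open>ev_step\<close> equates the value of \<open>r\<close>
    with the successor of its predecessor; this forces it to be positive and provides
    \<open>w\<close>.\<close>
  from step.hyps(3) consider
      "t = 4" "qe = e" "qn = n" "qv = v1" "re = e'" "rn = n" "rv = v2"
    | "t = 5" "qe = e'" "qn = n" "re = e" "rn = qv" "rv = v"
    | "t = 6" "k = 0" "qe = e" "qn = a" "qv = v"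
    | j where "t = 6" "k = Suc j" "qe = \<langle>(6, \<langle>(e, e')\<rangle>)\<rangle>" "qn = \<langle>(a, j)\<rangle>" "re = e'"
        "rn = \<langle>(a, \<langle>(j, qv)\<rangle>)\<rangle>" "rv = v"
    | "t = 7" "qe = \<langle>(e, e')\<rangle>" "qn = \<langle>(n, v)\<rangle>" "qv = 0" "re = \<langle>(8, \<langle>(e, e')\<rangle>)\<rangle>"
        "rn = \<langle>(n, v)\<rangle>" "rv = 0"
    | j w where "t = 8" "k = Suc j" "v = 0" "qe = \<langle>(8, \<langle>(e, e')\<rangle>)\<rangle>" "qn = \<langle>(a, j)\<rangle>" "qv = 0"
        "re = \<langle>(e, e')\<rangle>" "rn = \<langle>(a, j)\<rangle>" "rv = Suc w"
    unfolding c by (auto simp: ev_step_def q r n v gr0_conv_Suc)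
  then show ?case
  proof cases
    case 1
    then show ?thesis using IH by (simp add: c v ev.intros)
  next
    case 2
    then show ?thesis using IH by (auto simp: c intro: ev.intros)
  next
    case 3
    then show ?thesis using IH by (auto simp: c n intro: ev.intros)
  next
    case 4
    then show ?thesis using IH by (auto simp: c n intro: ev.intros)
  next
    case 5
    then show ?thesis using IH by (auto simp: c intro: ev.intros)
  next
    case 6
    then show ?thesis using IH by (auto simp: c n intro: ev.intros)
  qed
qed

lemma sigma1_ev: "sigma1 (\<lambda>c. ev (p1 c) (p1 (p2 c)) (p2 (p2 c)))"
proof -
  have "ev_closure c \<longleftrightarrow> ev (p1 c) (p1 (p2 c)) (p2 (p2 c))" for c
    using ev_imp_closure[of "p1 c" "p1 (p2 c)" "p2 (p2 c)"] closure_imp_ev by auto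
  moreover have "decidable (\<lambda>c. ev_ax (p1 c) (p1 (p2 c)) (p2 (p2 c)))"
    unfolding ev_ax_def by (intro rec_intros)
  then have "sigma1 ev_closure"
  proof (rule sigma1_rule_closure)
    show "decidable (\<lambda>e. ev_step (p1 e) (p1 (p2 e)) (p1 (p2 (p2 e))) (p1 (p2 (p2 (p2 e)))) (p2 (p2 (p2 (p2 e)))))"
      unfolding ev_step_def by (intro rec_intros)
  qed
  ultimately show ?thesis by presburger
qed

lemma ev_basic_iff:
  "ev \<langle>(0, c)\<rangle> n v \<longleftrightarrow> v = 0"
  "ev \<langle>(1, c)\<rangle> n v \<longleftrightarrow> v = Suc n"
  "ev \<langle>(2, c)\<rangle> n v \<longleftrightarrow> v = p1 n"
  "ev \<langle>(3, c)\<rangle> n v \<longleftrightarrow> v = p2 n"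
  by (subst ev.simps; auto)+

lemma ev_pair_iff:
  "ev \<langle>(4, \<langle>(e, e')\<rangle>)\<rangle> n v \<longleftrightarrow> (\<exists>a b. v = \<langle>(a, b)\<rangle> \<and> ev e n a \<and> ev e' n b)"
  by (subst ev.simps) auto

lemma ev_comp_iff: "ev \<langle>(5, \<langle>(e, e')\<rangle>)\<rangle> n v \<longleftrightarrow> (\<exists>a. ev e' n a \<and> ev e a v)"
  by (subst ev.simps) auto

lemma ev_rec_iff:
  "ev \<langle>(6, \<langle>(e, e')\<rangle>)\<rangle> \<langle>(a, 0)\<rangle> v \<longleftrightarrow> ev e a v"
  "ev \<langle>(6, \<langle>(e, e')\<rangle>)\<rangle> \<langle>(a, Suc j)\<rangle> v \<longleftrightarrow>
     (\<exists>r. ev \<langle>(6, \<langle>(e, e')\<rangle>)\<rangle> \<langle>(a, j)\<rangle> r \<and> ev e' \<langle>(a, \<langle>(j, r)\<rangle>)\<rangle> v)"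
  by (subst ev.simps; auto)+

lemma ev_mu_iff:
  "ev \<langle>(7, e)\<rangle> a n \<longleftrightarrow> ev e \<langle>(a, n)\<rangle> 0 \<and> ev \<langle>(8, e)\<rangle> \<langle>(a, n)\<rangle> 0"
  "ev \<langle>(8, e)\<rangle> \<langle>(a, 0)\<rangle> 0"
  "ev \<langle>(8, e)\<rangle> \<langle>(a, Suc n)\<rangle> 0 \<longleftrightarrow> ev \<langle>(8, e)\<rangle> \<langle>(a, n)\<rangle> 0 \<and> (\<exists>v. ev e \<langle>(a, n)\<rangle> (Suc v))"
  by (subst ev.simps; auto)+

lemma is_mu_unique: "is_mu f a n \<Longrightarrow> is_mu f a m \<Longrightarrow> n = m"
  unfolding is_mu_def by (metis linorder_neqE_nat nat.distinct(1) option.inject)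

text \<open>The tags 0 to 7 follow the eight clauses of \<open>partial_recursive\<close> in order,
  so a code is assembled along the construction of \<open>f\<close>.\<close>

lemma ev_universal: "partial_recursive f \<Longrightarrow> \<exists>e. \<forall>n v. ev e n v \<longleftrightarrow> f n = Some v"
proof (induction rule: partial_recursive.induct)
  case zero
  show ?case by (rule exI[of _ "\<langle>(0, 0)\<rangle>"]) (auto simp: ev_basic_iff)
next
  case succ
  show ?case by (rule exI[of _ "\<langle>(1, 0)\<rangle>"]) (auto simp: ev_basic_iff[simplified])
next
  case proj1
  show ?case by (rule exI[of _ "\<langle>(2, 0)\<rangle>"]) (auto simp: ev_basic_iff)
next
  case proj2
  show ?case by (rule exI[of _ "\<langle>(3, 0)\<rangle>"]) (auto simp: ev_basic_iff)
next
  case (pair f g)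
  then obtain e e' where "\<And>n v. ev e n v \<longleftrightarrow> f n = Some v" "\<And>n v. ev e' n v \<longleftrightarrow> g n = Some v"
    by blast
  then show ?case
    by (intro exI[of _ "\<langle>(4, \<langle>(e, e')\<rangle>)\<rangle>"]) (auto simp: ev_pair_iff bind_eq_Some_conv)
next
  case (comp f g)
  then obtain e e' where "\<And>n v. ev e n v \<longleftrightarrow> f n = Some v" "\<And>n v. ev e' n v \<longleftrightarrow> g n = Some v"
    by blast
  then show ?case
    by (intro exI[of _ "\<langle>(5, \<langle>(e, e')\<rangle>)\<rangle>"]) (auto simp: ev_comp_iff bind_eq_Some_conv)
next
  case (prim_rec f g)
  then obtain e e' where e: "\<And>n v. ev e n v \<longleftrightarrow> f n = Some v" "\<And>n v. ev e' n v \<longleftrightarrow> g n = Some v"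
    by blast
  have "ev \<langle>(6, \<langle>(e, e')\<rangle>)\<rangle> \<langle>(a, k)\<rangle> v \<longleftrightarrow>
      rec_nat (f a) (\<lambda>j r. Option.bind r (\<lambda>v. g \<langle>(a, \<langle>(j, v)\<rangle>)\<rangle>)) k = Some v" for a k v
    by (induction k arbitrary: v) (auto simp: e ev_rec_iff bind_eq_Some_conv)
  then have "ev \<langle>(6, \<langle>(e, e')\<rangle>)\<rangle> n v \<longleftrightarrow> (case prod_decode n of (a, k) \<Rightarrow>
      rec_nat (f a) (\<lambda>j r. Option.bind r (\<lambda>v. g \<langle>(a, \<langle>(j, v)\<rangle>)\<rangle>)) k) = Some v" for n v
    by (cases n rule: prod_encode_cases) simp
  then show ?case by blast
next
  case (mu f)
  then obtain e where e: "\<And>n v. ev e n v \<longleftrightarrow> f n = Some v"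
    by blast
  \<comment> \<open>Tag 8 expresses the second conjunct of \<open>is_mu\<close>.\<close>
  have "ev \<langle>(8, e)\<rangle> \<langle>(a, n)\<rangle> 0 \<longleftrightarrow> (\<forall>m<n. \<exists>v. f \<langle>(a, m)\<rangle> = Some (Suc v))" for a n
    by (induction n) (auto simp: e ev_mu_iff less_Suc_eq)
  then have mu_iff: "ev \<langle>(7, e)\<rangle> a n \<longleftrightarrow> is_mu f a n" for a n
    by (simp add: e ev_mu_iff is_mu_def)
  have the: "(THE n. is_mu f a n) = n" if "is_mu f a n" for a n
    using that by (blast dest: is_mu_unique)
  have "is_mu f a n \<longleftrightarrow> (if \<exists>n. is_mu f a n then Some (THE n. is_mu f a n) else None) = Some n" for a n
    using the by auto
  with mu_iff show ?case by blast
qed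

section \<open>The diagonal equivalence relation\<close>

definition spike :: "nat \<Rightarrow> cantor" where "spike n = (\<lambda>i. i = n)"
definition cospike :: "nat \<Rightarrow> cantor" where "cospike n = (\<lambda>i. i \<noteq> n)"

lemma spike_simps [simp]:
  "spike n = spike m \<longleftrightarrow> n = m" "cospike n = cospike m \<longleftrightarrow> n = m"
  "spike n \<noteq> cospike m" "cospike m \<noteq> spike n"
proof -
  show "spike n = spike m \<longleftrightarrow> n = m" "cospike n = cospike m \<longleftrightarrow> n = m"
    by (auto simp: spike_def cospike_def fun_eq_iff)
  have "spike n (Suc (n + m)) \<noteq> cospike m (Suc (n + m))"
    by (simp add: spike_def cospike_def)
  then show "spike n \<noteq> cospike m" "cospike m \<noteq> spike n"
    by auto
qed

text \<open>The point \<open>(spike n, cospike n, z)\<close> lies in the open set whose boxes are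
  the codes in the domain of program \<open>n\<close>.\<close>

definition diag_hit :: "nat \<Rightarrow> baire \<Rightarrow> bool" where
  "diag_hit n z \<longleftrightarrow> (\<exists>s t u. (\<exists>v. ev n (box_code s t u) v) \<and>
     spike n \<in> cyl s \<and> cospike n \<in> cyl t \<and> z \<in> cyl u)"

text \<open>The \<open>n\<close> with \<open>(spike n, cospike n)\<close> in the \<open>n\<close>-th
  \<open>\<Sigma>\<^sup>1\<^sub>1\<close> relation, the projection of the complement of the
  \<open>n\<close>-th open set.\<close>

definition diag_set :: "nat set" where
  "diag_set = {n. \<exists>z. \<not> diag_hit n z}"

definition diag_graph :: "(cantor \<times> cantor) set" where
  "diag_graph = (\<Union>n\<in>diag_set. {(spike n, cospike n), (cospike n, spike n)})"

text \<open>
  \<open>z 0\<close> announces which clause puts \<open>(x, y)\<close> into the relation: equality if it is 0, and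
  membership of \<open>z 0 - 1\<close> in \<open>diag_set\<close>, witnessed by the rest of \<open>z\<close>, otherwise.
\<close>

definition diag_bad :: "cantor \<Rightarrow> cantor \<Rightarrow> baire \<Rightarrow> bool" where
  "diag_bad x y z \<longleftrightarrow> (z 0 = 0 \<and> x \<noteq> y) \<or>
     (z 0 \<noteq> 0 \<and> ((\<exists>i. x i = y i) \<or> (x \<noteq> spike (z 0 - 1) \<and> y \<noteq> spike (z 0 - 1)) \<or>
        diag_hit (z 0 - 1) (z \<circ> Suc)))"

text \<open>If \<open>x\<close> and \<open>y\<close> differ at every coordinate and one of them is
  \<open>spike n\<close>, then the other is \<open>cospike n\<close>.\<close>

lemma diag_graph_iff: "(x, y) \<in> diag_graph\<^sup>= \<longleftrightarrow> (\<exists>z. \<not> diag_bad x y z)"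
proof
  assume "(x, y) \<in> diag_graph\<^sup>="
  then consider "x = y" | n where "n \<in> diag_set" "(x, y) = (spike n, cospike n) \<or> (x, y) = (cospike n, spike n)"
    by (auto simp: diag_graph_def)
  then show "\<exists>z. \<not> diag_bad x y z"
  proof cases
    case 1
    then show ?thesis by (intro exI[of _ "\<lambda>_. 0"]) (simp add: diag_bad_def)
  next
    case 2
    then obtain z where "\<not> diag_hit n z" by (auto simp: diag_set_def)
    moreover have "case_nat (Suc n) z \<circ> Suc = z" by (simp add: fun_eq_iff)
    ultimately show ?thesis
      using 2 by (intro exI[of _ "case_nat (Suc n) z"]) (auto simp: diag_bad_def spike_def cospike_def)
  qed
next
  assume "\<exists>z. \<not> diag_bad x y z"
  then obtain z where z: "\<not> diag_bad x y z" ..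
  show "(x, y) \<in> diag_graph\<^sup>="
  proof (cases "z 0")
    case 0
    with z show ?thesis by (simp add: diag_bad_def)
  next
    case (Suc n)
    with z have "n \<in> diag_set" "\<And>i. y i \<longleftrightarrow> \<not> x i" "x = spike n \<or> y = spike n"
      by (auto simp: diag_bad_def diag_set_def)
    moreover from this have "y = cospike n \<or> x = cospike n"
      by (auto simp: spike_def cospike_def fun_eq_iff)
    ultimately show ?thesis
      by (auto simp: diag_graph_def spike_def cospike_def fun_eq_iff)
  qed
qed

section \<open>The diagonal relation is \<open>\<Sigma>\<^sup>1\<^sub>1\<close>\<close>

lemma sigma1_ev_comp:
  assumes "recursive f" "recursive g" "recursive h"
  shows "sigma1 (\<lambda>x. ev (f x) (g x) (h x))"
  using sigma1_comp[OF sigma1_ev recursive_pair[OF assms(1) recursive_pair[OF assms(2,3)]]] by simp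

text \<open>
  \<open>hd (drop i s)\<close> replaces \<open>s ! i\<close> because it is recursive in \<open>i\<close> even past the end of the list,
  where \<open>(!)\<close> is unspecified.
\<close>

definition diag_code :: "nat \<Rightarrow> nat list \<Rightarrow> nat list \<Rightarrow> nat list \<Rightarrow> bool" where
  "diag_code n s t u \<longleftrightarrow>
     hd u = 0 \<and> (\<exists>i<length s. i < length t \<and> hd (drop i s) \<noteq> hd (drop i t)) \<or>
     hd u \<noteq> 0 \<and>
      ((\<exists>i<length s. i < length t \<and> hd (drop i s) = hd (drop i t)) \<or>
       (\<exists>i<length s. \<exists>j<length t. hd (drop i s) \<noteq> of_bool (i = n) \<and> hd (drop j t) \<noteq> of_bool (j = n)) \<or>
       (\<exists>c d v. ev n \<langle>(c, \<langle>(d, list_encode (tl u))\<rangle>)\<rangle> v \<and>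
          (\<forall>i<length (list_decode c). hd (drop i (list_decode c)) = of_bool (i = n)) \<and>
          (\<forall>i<length (list_decode d). hd (drop i (list_decode d)) = of_bool (i \<noteq> n))))"

text \<open>These codes index the boxes whose union is \<open>diag_bad\<close>. The guard makes the
  third list nonempty, so that its head is a genuine value of \<open>z 0\<close>.\<close>

lemma sigma1_diag_code:
  "sigma1 (\<lambda>c. p2 (p2 c) \<noteq> 0 \<and> diag_code (hd (list_decode (p2 (p2 c))) - 1) (list_decode (p1 c))
     (list_decode (p1 (p2 c))) (list_decode (p2 (p2 c))))"
  unfolding diag_code_def
  by (intro sigma1_conj sigma1_disj sigma1_ex sigma1_ev_comp sigma1_decidable rec_intros)

lemma in_cyl_prefix [simp]: "x \<in> cyl (map x [0..<k])"
  by (simp add: cyl_def)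

text \<open>A single entrywise condition says both that \<open>c\<close> codes a Boolean list and
  that \<open>x\<close> extends this list.\<close>

lemma list_code_in_cyl_iff:
  "(\<forall>i<length (list_decode c). hd (drop i (list_decode c)) = of_bool (x i)) \<longleftrightarrow>
     (\<exists>s. c = list_encode (map of_bool s) \<and> x \<in> cyl s)"
proof
  assume *: "\<forall>i<length (list_decode c). hd (drop i (list_decode c)) = of_bool (x i)"
  have "list_decode c = map of_bool (map x [0..<length (list_decode c)])"
    by (rule nth_equalityI) (use * in \<open>simp_all add: hd_drop_conv_nth\<close>)
  then have "c = list_encode (map of_bool (map x [0..<length (list_decode c)]))"
    by (metis list_decode_inverse)
  then show "\<exists>s. c = list_encode (map of_bool s) \<and> x \<in> cyl s"
    using in_cyl_prefix by blast
qed (auto simp: cyl_def hd_drop_conv_nth)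

text \<open>\<open>of_bool\<close> is injective, so comparing coded entries compares truth values;
  the codes \<open>c\<close> and \<open>d\<close> turn into Boolean lists by
  \<open>list_code_in_cyl_iff\<close>.\<close>

lemma diag_code_iff:
  "diag_code n (map of_bool s) (map of_bool t) u \<longleftrightarrow>
     hd u = 0 \<and> (\<exists>i<length s. i < length t \<and> s ! i \<noteq> t ! i) \<or>
     hd u \<noteq> 0 \<and>
      ((\<exists>i<length s. i < length t \<and> s ! i = t ! i) \<or>
       (\<exists>i<length s. \<exists>j<length t. s ! i \<noteq> spike n i \<and> t ! j \<noteq> spike n j) \<or>
       (\<exists>s t v. ev n (box_code s t (tl u)) v \<and> spike n \<in> cyl s \<and> cospike n \<in> cyl t))"
proof -
  have spike_iff: "(\<forall>i<length (list_decode c). hd (drop i (list_decode c)) = of_bool (i = n)) \<longleftrightarrow>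
      (\<exists>s. c = list_encode (map of_bool s) \<and> spike n \<in> cyl s)" for c
    using list_code_in_cyl_iff[of c "spike n"] unfolding spike_def .
  have cospike_iff: "(\<forall>i<length (list_decode c). hd (drop i (list_decode c)) = of_bool (i \<noteq> n)) \<longleftrightarrow>
      (\<exists>s. c = list_encode (map of_bool s) \<and> cospike n \<in> cyl s)" for c
    using list_code_in_cyl_iff[of c "cospike n"] unfolding cospike_def .
  have hit: "(\<exists>c d v. ev n \<langle>(c, \<langle>(d, list_encode (tl u))\<rangle>)\<rangle> v \<and>
          (\<forall>i<length (list_decode c). hd (drop i (list_decode c)) = of_bool (i = n)) \<and>
          (\<forall>i<length (list_decode d). hd (drop i (list_decode d)) = of_bool (i \<noteq> n))) \<longleftrightarrow>
        (\<exists>s t v. ev n (box_code s t (tl u)) v \<and> spike n \<in> cyl s \<and> cospike n \<in> cyl t)"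
    unfolding box_code_def spike_iff cospike_iff by blast
  have nth: "hd (drop i (map of_bool s)) = (of_bool (s ! i) :: nat)" if "i < length s" for i s
    using that by (simp add: hd_drop_conv_nth)
  have spike: "spike n i \<longleftrightarrow> i = n" for i
    by (simp add: spike_def)
  show ?thesis
    unfolding diag_code_def hit by (simp only: length_map nth spike of_bool_eq_iff cong: conj_cong)
qed

text \<open>Each clause of \<open>diag_bad\<close> is an open condition, hence settled by finite
  prefixes of \<open>x\<close>, \<open>y\<close> and \<open>z\<close>; conversely, such prefixes
  settle it for all their extensions.\<close>

lemma diag_bad_iff_code:
  "diag_bad x y z \<longleftrightarrow> (\<exists>s t u. (u \<noteq> [] \<and> diag_code (hd u - 1) (map of_bool s) (map of_bool t) u) \<and>
     x \<in> cyl s \<and> y \<in> cyl t \<and> z \<in> cyl u)" (is "_ \<longleftrightarrow> ?R")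
proof
  have R: ?R if "u \<noteq> []" "diag_code (hd u - 1) (map of_bool s) (map of_bool t) u"
    "x \<in> cyl s" "y \<in> cyl t" "z \<in> cyl u" for s t u
    using that by blast
  have z0: "z \<in> cyl [z 0]" by (simp add: cyl_def)
  have nil: "x \<in> cyl []" "y \<in> cyl []" by (simp_all add: cyl_def)
  assume "diag_bad x y z"
  then consider i where "z 0 = 0" "x i \<noteq> y i" | i where "z 0 \<noteq> 0" "x i = y i"
    | i j where "z 0 \<noteq> 0" "x i \<noteq> spike (z 0 - 1) i" "y j \<noteq> spike (z 0 - 1) j"
    | s t u v where "z 0 \<noteq> 0" "ev (z 0 - 1) (box_code s t u) v" "spike (z 0 - 1) \<in> cyl s"
       "cospike (z 0 - 1) \<in> cyl t" "z \<circ> Suc \<in> cyl u"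
    unfolding diag_bad_def diag_hit_def by (auto simp: fun_eq_iff[of x] fun_eq_iff[of y])
  then show ?R
  proof cases
    case 1
    then show ?thesis
      \<comment> \<open>Prefixes of length \<open>Suc i\<close> are the shortest that show
        coordinate \<open>i\<close>.\<close>
      by (intro R[of "[z 0]" "map x [0..<Suc i]" "map y [0..<Suc i]"] in_cyl_prefix z0)
        (auto simp: diag_code_iff simp del: upt_Suc map_map intro!: exI[of _ i])
  next
    case 2
    then show ?thesis
      by (intro R[of "[z 0]" "map x [0..<Suc i]" "map y [0..<Suc i]"] in_cyl_prefix z0)
        (auto simp: diag_code_iff simp del: upt_Suc map_map intro!: exI[of _ i])
  next
    case 3
    then have "\<exists>k<Suc i. \<exists>l<Suc j. x k \<noteq> spike (z 0 - 1) k \<and> y l \<noteq> spike (z 0 - 1) l"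
      by blast
    with 3 show ?thesis
      by (intro R[of "[z 0]" "map x [0..<Suc i]" "map y [0..<Suc j]"] in_cyl_prefix z0)
        (simp_all add: diag_code_iff del: upt_Suc map_map cong: conj_cong)
  next
    case 4
    \<comment> \<open>The box \<open>u\<close> constrains the shifted sequence; putting
      \<open>z 0\<close> in front turns it into a box for \<open>z\<close>. The clause restricts
      neither \<open>x\<close> nor \<open>y\<close>, so their boxes are empty lists.\<close>
    then have "z \<in> cyl (z 0 # u)"
      by (simp add: cyl_def All_less_Suc2)
    with 4 show ?thesis
      by (intro R[of "z 0 # u" "[]" "[]"] nil)
        (auto simp: diag_code_iff[of _ "[]" "[]", simplified])
  qed
next
  assume ?R
  then obtain s t u where *: "u \<noteq> []" "diag_code (hd u - 1) (map of_bool s) (map of_bool t) u"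
    "x \<in> cyl s" "y \<in> cyl t" "z \<in> cyl u"
    by blast
  have z0: "hd u = z 0"
    using *(1,5) by (simp add: cyl_def hd_conv_nth)
  have tl: "z \<circ> Suc \<in> cyl (tl u)"
    using *(5) by (simp add: cyl_def nth_tl)
  have st: "\<And>i. i < length s \<Longrightarrow> s ! i = x i" "\<And>i. i < length t \<Longrightarrow> t ! i = y i"
    using *(3,4) by (simp_all add: cyl_def)
  show "diag_bad x y z"
    using *(2) tl unfolding diag_code_iff diag_bad_def diag_hit_def z0
    by (elim disjE exE conjE) (auto simp: st, blast+)
qed

lemma lightface_Sigma11_diag: "lightface_Sigma11 (diag_graph\<^sup>=)"
proof -
  let ?W = "\<lambda>c. p2 (p2 c) \<noteq> 0 \<and> diag_code (hd (list_decode (p2 (p2 c))) - 1) (list_decode (p1 c))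
     (list_decode (p1 (p2 c))) (list_decode (p2 (p2 c)))"
  have "{(x, y, z). diag_bad x y z} =
      {(x, y, z). \<exists>s t u. box_code s t u \<in> {c. ?W c} \<and> x \<in> cyl s \<and> y \<in> cyl t \<and> z \<in> cyl u}"
    by (simp add: box_code_def list_encode_eq_0 diag_bad_iff_code del: neq0_conv)
  with semirecursive_sigma1[OF sigma1_diag_code]
  have "lightface_Sigma01 {(x, y, z). diag_bad x y z}"
    unfolding lightface_Sigma01_def by blast
  then have "lightface_Pi01 (- {(x, y, z). diag_bad x y z})"
    by (simp add: lightface_Pi01_def)
  moreover have "diag_graph\<^sup>= = {(x, y). \<exists>z. (x, y, z) \<in> - {(x, y, z). diag_bad x y z}}"
    using diag_graph_iff by auto
  ultimately show ?thesis
    unfolding lightface_Sigma11_def by blast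
qed

section \<open>Diagonalization\<close>

text \<open>The required \<open>n\<close> is a program code for the semirecursive set of boxes that
  defines the complement of the closed set projecting to \<open>A\<close>.\<close>

lemma diag_set_diagonalizes:
  assumes "lightface_Sigma11 A"
  shows "\<exists>n. (spike n, cospike n) \<in> A \<longleftrightarrow> n \<in> diag_set"
proof -
  obtain P W f where A: "A = {(x, y). \<exists>z. (x, y, z) \<in> P}" and f: "partial_recursive f" and W: "W = dom f"
    and P: "- P = {(x, y, z). \<exists>s t u. box_code s t u \<in> W \<and> x \<in> cyl s \<and> y \<in> cyl t \<and> z \<in> cyl u}"
    using assms unfolding lightface_Sigma11_def lightface_Pi01_def lightface_Sigma01_def semirecursive_def
    by blast
  from ev_universal[OF f] obtain e where e: "\<And>n v. ev e n v \<longleftrightarrow> f n = Some v"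
    by blast
  have "(spike e, cospike e, z) \<in> - P \<longleftrightarrow> diag_hit e z" for z
    unfolding P W diag_hit_def e dom_def by auto
  then have "(spike e, cospike e) \<in> A \<longleftrightarrow> e \<in> diag_set"
    by (auto simp: A diag_set_def)
  then show ?thesis ..
qed

section \<open>Borel graphability and the conclusion\<close>

lemma closed_singleton_cantor: "closed {a :: cantor}"
proof -
  have "closed {x :: cantor. \<forall>i. x i = a i}"
    by (intro closed_Collect_all closed_Collect_eq continuous_on_product_coordinates continuous_on_const)
  moreover have "{x. \<forall>i. x i = a i} = {a}"
    by (auto simp: fun_eq_iff)
  ultimately show ?thesis by simp
qed

text \<open>Singletons are closed, so a countable set is a countable union of closed sets. This
  makes \<open>diag_graph\<close> Borel however complex \<open>diag_set\<close> is.\<close>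

lemma borel_countable_cantor2:
  fixes A :: "(cantor \<times> cantor) set"
  assumes "countable A"
  shows "A \<in> sets borel"
proof (rule sets.countable[OF _ assms])
  fix p :: "cantor \<times> cantor"
  have "closed ({fst p} \<times> {snd p})"
    by (intro closed_Times closed_singleton_cantor)
  then show "{p} \<in> sets borel"
    by (intro borel_closed) simp
qed

lemma simple_graph_diag: "simple_graph diag_graph"
  by (auto simp: simple_graph_def diag_graph_def irrefl_def sym_def)

text \<open>The pairs joined by \<open>diag_graph\<close> are disjoint for distinct
  \<open>n\<close>, so two consecutive edges lead back to the start.\<close>

lemma trans_diag: "trans (diag_graph\<^sup>=)"
  by (auto simp: trans_def diag_graph_def)

lemma diag_rtrancl: "diag_graph\<^sup>* = diag_graph\<^sup>="
  using trans_diag by (metis reflcl_trancl rtrancl_reflcl trancl_id trancl_reflcl)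

theorem theorem5p2:
  shows "\<exists>E :: (cantor \<times> cantor) set.
    equiv UNIV E \<and> lightface_Sigma11 E \<and> Borel_graphable E \<and> \<not> Delta11_graphable E"
proof (intro exI[of _ "diag_graph\<^sup>="] conjI)
  show "equiv UNIV (diag_graph\<^sup>=)"
    using trans_diag simple_graph_diag
    by (auto simp: equiv_def refl_on_def simple_graph_def sym_def)
  show "lightface_Sigma11 (diag_graph\<^sup>=)"
    by (rule lightface_Sigma11_diag)
  have "countable diag_graph"
    by (simp add: diag_graph_def)
  then show "Borel_graphable (diag_graph\<^sup>=)"
    unfolding Borel_graphable_def
    by (intro exI[of _ diag_graph] conjI simple_graph_diag diag_rtrancl borel_countable_cantor2)
  show "\<not> Delta11_graphable (diag_graph\<^sup>=)"
  proof
    assume "Delta11_graphable (diag_graph\<^sup>=)"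
    then obtain G where G: "irrefl G" "lightface_Sigma11 (- G)" "G\<^sup>* = diag_graph\<^sup>="
      by (auto simp: Delta11_graphable_def lightface_Delta11_def simple_graph_def)
    \<comment> \<open>Diagonalizing against the complement of \<open>G\<close> makes the edge absent
      from \<open>G\<close> exactly when \<open>diag_graph\<close> contains it.\<close>
    from diag_set_diagonalizes[OF G(2)] obtain n where n: "(spike n, cospike n) \<notin> G \<longleftrightarrow> n \<in> diag_set"
      by auto
    show False
    proof (cases "n \<in> diag_set")
      case True
      then have "(spike n, cospike n) \<in> G\<^sup>*"
        unfolding G(3) by (auto simp: diag_graph_def)
      \<comment> \<open>A path between distinct points has a first edge. It stays in a class of two
        elements and is not a loop, so it must end at \<open>cospike n\<close>.\<close>
      then obtain w where w: "(spike n, w) \<in> G"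
        by (rule converse_rtranclE) auto
      then have "w \<noteq> spike n" "(spike n, w) \<in> diag_graph\<^sup>="
        using G(1,3) by (auto simp: irrefl_def)
      then have "w = cospike n"
        by (auto simp: diag_graph_def)
      with w n True show False by simp
    next
      case False
      then have "(spike n, cospike n) \<in> diag_graph\<^sup>="
        using n G(3) by auto
      with False show False by (auto simp: diag_graph_def)
    qed
  qed
qed

end
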